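(* (Part 1) For each integer $m \geq 1$ there is a graph $G_m$ on $m^m$ vertices with $\alpha(G_m)=m$ and with $$i_1(G_m)=i_2(G_m)=\cdots=i_m(G_m)=m^m;$$ thus $f(m)\le m^m$. (Part 2) On the other hand, for each integer $m\ge 1$, if $G$ is a graph with $\alpha(G)=m$ and $i_m(G)<m^m$, then $i_m(G)<i_{m-1}(G)$; thus $f(m)\ge m^m$.
   Context: All graphs are finite and simple. An independent set is a set of mutually non-adjacent vertices; $\alpha(G)$ is the size of the largest independent set of $G$, and $i_k(G)$ is the number of independent sets of size $k$ in $G$ (with $i_0(G)=1$). For a graph $G$ with $\alpha(G)=m$, a permutation $\pi$ of $[m]=\{1,\ldots,m\}$ is an independent set permutation of $G$ if $i_{\pi(1)}(G)\le i_{\pi(2)}(G)\le\cdots\le i_{\pi(m)}(G)$ (ties are allowed, so a graph may have several independent set permutations). For a permutation $\pi$ of $[m]$, $g(\pi)$ denotes the minimum number of vertices over all graphs $G$ with $\alpha(G)=m$ for which $\pi$ is an independent set permutation of $G$, and $f(m)$ denotes the maximum of $g(\pi)$ over all permutations $\pi$ of $[m]$. *)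

theory Defs
  imports "Graph_Theory.Pair_Digraph" "HOL-Combinatorics.Permutations"
begin

text \<open>
  A finite simple graph is a \<open>pair_graph\<close>: a finite vertex set \<open>pverts G\<close> with a symmetric,
  irreflexive set \<open>parcs G\<close> of ordered pairs of vertices, an edge \<open>uv\<close> being represented by the
  two pairs \<open>(u, v)\<close> and \<open>(v, u)\<close>.
\<close>

definition independent_set :: "'a pair_pre_digraph \<Rightarrow> 'a set \<Rightarrow> bool" where
  "independent_set G S \<longleftrightarrow> S \<subseteq> pverts G \<and> (\<forall>u\<in>S. \<forall>v\<in>S. (u, v) \<notin> parcs G)"

definition indep_number :: "'a pair_pre_digraph \<Rightarrow> nat" where
  "indep_number G = Max (card ` {S. independent_set G S})"

definition indep_count :: "'a pair_pre_digraph \<Rightarrow> nat \<Rightarrow> nat" where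
  "indep_count G k = card {S. independent_set G S \<and> card S = k}"

definition indep_set_permutation :: "'a pair_pre_digraph \<Rightarrow> (nat \<Rightarrow> nat) \<Rightarrow> bool" where
  "indep_set_permutation G \<pi> \<longleftrightarrow>
     \<pi> permutes {1..indep_number G} \<and>
     (\<forall>j\<in>{1..<indep_number G}. indep_count G (\<pi> j) \<le> indep_count G (\<pi> (j + 1)))"

text \<open>
  The minimum number \<open>g(\<pi>)\<close> of vertices, for a permutation \<open>\<pi>\<close> of \<open>{1..m}\<close>. The parameter \<open>m\<close>
  is explicit because \<open>\<pi> permutes {1..m}\<close> does not determine it. Every finite graph is
  isomorphic to one whose vertices are natural numbers, so these suffice. A graph with
  independence number \<open>m \<ge> 1\<close> and \<open>i\<^sub>1 = \<dots> = i\<^sub>m\<close> admits every permutation of \<open>{1..m}\<close>; the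
  existence of such graphs makes the minimum well defined.
\<close>

definition min_vertices :: "nat \<Rightarrow> (nat \<Rightarrow> nat) \<Rightarrow> nat" where
  "min_vertices m \<pi> =
     (LEAST n. \<exists>G :: nat pair_pre_digraph. pair_graph G \<and> indep_number G = m \<and>
        indep_set_permutation G \<pi> \<and> card (pverts G) = n)"

text \<open>The maximum \<open>f(m)\<close> of \<open>g(\<pi>)\<close> over all permutations \<open>\<pi>\<close> of \<open>{1..m}\<close>.\<close>

definition max_min_vertices :: "nat \<Rightarrow> nat" where
  "max_min_vertices m = Max (min_vertices m ` {\<pi>. \<pi> permutes {1..m}})"

end

theory Submission
  imports Defs
begin

text \<open>
  Part 2 rests on the inequality \<open>m\<^sup>m i\<^sub>m\<^sup>m\<^sup>-\<^sup>1 \<le> i\<^sub>m\<^sub>-\<^sub>1\<^sup>m\<close> for graphs with independence number \<open>m\<close>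
  (\<open>top_indep_counts_inequality\<close>): if \<open>i\<^sub>m\<^sub>-\<^sub>1 \<le> i\<^sub>m\<close>, it leaves \<open>m\<^sup>m \<le> i\<^sub>m\<close>. It is proved
  by induction on \<open>m\<close>. Let \<open>v\<close> be a vertex whose set \<open>N\<close> of non-neighbours contains the largest
  number \<open>A\<close> of independent \<open>(m-1)\<close>-sets. No independent \<open>m\<close>-set lies inside \<open>N\<close>, since \<open>v\<close> could be
  added to it. So if the vertices outside \<open>N\<close> are deleted one at a time, every independent
  \<open>m\<close>-set is destroyed, and all independent \<open>(m-1)\<close>-sets but the \<open>A\<close> ones inside \<open>N\<close> are
  destroyed. A deletion destroys \<open>a\<close> sets of the first and \<open>b\<close> of the second kind, where \<open>a\<close> and \<open>b\<close>
  are the top counts of a graph to which the induction hypothesis applies and \<open>a \<le> A\<close>; hence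
  \<open>(m-1) a \<le> c b\<close> for \<open>c = A\<^sup>1\<^sup>/\<^sup>(\<^sup>m\<^sup>-\<^sup>1\<^sup>)\<close>. Summing gives
  \<open>i\<^sub>m\<^sub>-\<^sub>1 \<ge> c\<^sup>m\<^sup>-\<^sup>1 + (m-1) i\<^sub>m / c\<close>, and the inequality of the means removes \<open>c\<close>.

  For Part 1 it is easier to describe cliques in the complement. Take layers
  \<open>0, \<dots>, m-1\<close>, layer \<open>t\<close> having \<open>w t \<ge> m\<close> vertices of which \<open>m\<close> are called core, and join a vertex
  to all core vertices of lower layers. In a clique all vertices but the one in the highest layer
  are core, so there are \<open>m\<^sup>k \<Sum>\<^sub>t w t (t choose k)\<close> cliques of size \<open>k + 1\<close>
  (\<open>card_indep_sets_layered\<close>). All these numbers equal \<open>m\<^sup>m\<close> for \<open>k < m\<close> precisely when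
  \<open>\<Sum>\<^sub>t w t (t choose k) = m\<^sup>m\<^sup>-\<^sup>k\<close>. This triangular system has a unique solution; what must be
  shown is that it satisfies \<open>w t \<ge> m\<close>, and that is done through a recursion for \<open>w t / m\<close>
  (\<open>layer_coeff_pos\<close>, \<open>layer_coeff_binomial_sum\<close>).

  The upper bound on \<open>f(m)\<close> is immediate from this graph, which admits every permutation. For the
  lower bound with \<open>m \<ge> 3\<close>, a graph that orders its counts as \<open>i\<^sub>2 \<le> \<dots> \<le> i\<^sub>m\<^sub>-\<^sub>1 \<le> i\<^sub>m \<le> i\<^sub>1\<close> has
  \<open>i\<^sub>m \<ge> m\<^sup>m\<close> by Part 2, hence at least \<open>m\<^sup>m\<close> vertices. For \<open>m = 2\<close> the sizes \<open>m - 1\<close> and \<open>1\<close>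
  coincide, and the order \<open>i\<^sub>1 \<le> i\<^sub>2\<close> is used instead.
\<close>

section \<open>Independent sets of a relation\<close>

text \<open>
  The vertex set is separate from the edge relation, so that a subgraph is obtained by
  shrinking \<open>U\<close> alone.
\<close>

definition indep_sets :: "('a \<times> 'a) set \<Rightarrow> 'a set \<Rightarrow> nat \<Rightarrow> 'a set set" where
  "indep_sets E U k = {S. S \<subseteq> U \<and> (\<forall>u\<in>S. \<forall>v\<in>S. (u, v) \<notin> E) \<and> card S = k}"

definition non_nbrs :: "('a \<times> 'a) set \<Rightarrow> 'a set \<Rightarrow> 'a \<Rightarrow> 'a set" where
  "non_nbrs E U v = {u \<in> U. u \<noteq> v \<and> (v, u) \<notin> E}"

lemma finite_indep_sets: "finite U \<Longrightarrow> finite (indep_sets E U k)"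
  by (rule finite_subset[of _ "Pow U"]) (auto simp: indep_sets_def)

lemma finite_non_nbrs: "finite U \<Longrightarrow> finite (non_nbrs E U v)"
  by (simp add: non_nbrs_def)

lemma indep_sets_mono: "U \<subseteq> U' \<Longrightarrow> indep_sets E U k \<subseteq> indep_sets E U' k"
  by (auto simp: indep_sets_def)

lemma card_indep_sets_mono:
  "U \<subseteq> U' \<Longrightarrow> finite U' \<Longrightarrow> card (indep_sets E U k) \<le> card (indep_sets E U' k)"
  by (intro card_mono finite_indep_sets indep_sets_mono)

lemma indep_sets_0: "finite U \<Longrightarrow> indep_sets E U 0 = {{}}"
  by (auto simp: indep_sets_def dest: finite_subset)

lemma indep_sets_empty_Suc: "indep_sets E {} (Suc k) = {}"
  by (auto simp: indep_sets_def)

text \<open>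
  An independent set that contains \<open>v\<close> is \<open>v\<close> together with an independent set of
  non-neighbours of \<open>v\<close>. Both halves of the development count by adding vertices in this way.
\<close>

lemma card_indep_sets_insert:
  assumes "sym E" "irrefl E" "finite U" "v \<notin> U"
  shows "card (indep_sets E (insert v U) (Suc k)) =
    card (indep_sets E U (Suc k)) + card (indep_sets E (non_nbrs E U v) k)"
proof -
  let ?I = "insert v ` indep_sets E (non_nbrs E U v) k"
  have loop: "(v, v) \<notin> E"
    using assms(2) by (auto simp: irrefl_def)
  have split: "indep_sets E (insert v U) (Suc k) = indep_sets E U (Suc k) \<union> ?I"
  proof (intro equalityI subsetI)
    fix S assume S: "S \<in> indep_sets E (insert v U) (Suc k)"
    hence fin: "finite S"
      by (simp add: indep_sets_def card_ge_0_finite)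
    show "S \<in> indep_sets E U (Suc k) \<union> ?I"
    proof (cases "v \<in> S")
      case True
      have "S - {v} \<in> indep_sets E (non_nbrs E U v) k"
        using S True fin by (auto simp: indep_sets_def non_nbrs_def)
      moreover have "S = insert v (S - {v})"
        using True by auto
      ultimately show ?thesis by blast
    qed (use S in \<open>auto simp: indep_sets_def\<close>)
  next
    fix S assume "S \<in> indep_sets E U (Suc k) \<union> ?I"
    thus "S \<in> indep_sets E (insert v U) (Suc k)"
    proof
      assume "S \<in> ?I"
      then obtain T where T: "T \<in> indep_sets E (non_nbrs E U v) k" "S = insert v T"
        by blast
      hence "finite T" "v \<notin> T"
        using assms(3) finite_subset[of T U] by (auto simp: indep_sets_def non_nbrs_def)
      thus ?thesis
        using T loop assms(1) by (auto simp: indep_sets_def non_nbrs_def dest: symD)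
    qed (auto simp: indep_sets_def)
  qed
  have "inj_on (insert v) (indep_sets E (non_nbrs E U v) k)"
    by (auto simp: inj_on_def indep_sets_def non_nbrs_def)
  moreover have "indep_sets E U (Suc k) \<inter> ?I = {}"
    using assms(4) by (auto simp: indep_sets_def)
  ultimately show ?thesis
    unfolding split using assms(3)
    by (simp add: card_Un_disjoint finite_indep_sets finite_non_nbrs card_image)
qed

section \<open>The two largest sizes of independent sets\<close>

text \<open>
  This is the inequality of the arithmetic and geometric means for \<open>c\<^sup>m\<close> and \<open>m\<close> copies of \<open>K / c\<close>,
  whose product \<open>K\<^sup>m\<close> does not depend on \<open>c\<close>. With only two distinct numbers it reduces to
  Bernoulli's inequality for the ratio of the mean to \<open>K / c\<close>.
\<close>

lemma am_gm_power:
  fixes c K :: real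
  assumes c: "c > 0" and K: "K > 0"
  shows "real (Suc m) ^ Suc m * K ^ m \<le> (c ^ m + real m * (K / c)) ^ Suc m"
proof -
  define t where "t = K / c"
  define s where "s = c ^ m + real m * t"
  have t: "t > 0" and Kct: "K = c * t"
    using c K by (simp_all add: t_def)
  have s: "s > 0"
    using c t by (simp add: s_def add_pos_nonneg)
  have "1 + real (Suc m) * (s / (real (Suc m) * t) - 1) \<le> (1 + (s / (real (Suc m) * t) - 1)) ^ Suc m"
    using s t by (intro Bernoulli_inequality) simp
  moreover have "1 + real (Suc m) * (s / (real (Suc m) * t) - 1) = c ^ m / t"
  proof -
    have "real (Suc m) * (s / (real (Suc m) * t)) = s / t"
      by simp
    moreover have "s / t = c ^ m / t + real m"
      using t by (simp add: s_def add_divide_distrib)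
    ultimately show ?thesis by (simp add: right_diff_distrib)
  qed
  ultimately have "c ^ m / t \<le> (s / (real (Suc m) * t)) ^ Suc m"
    by simp
  hence "c ^ m / t * (real (Suc m) * t) ^ Suc m \<le> s ^ Suc m"
    using t by (subst (asm) power_divide, subst (asm) pos_le_divide_eq) auto
  moreover have "c ^ m / t * (real (Suc m) * t) ^ Suc m = real (Suc m) ^ Suc m * K ^ m"
    using t unfolding Kct by (simp add: power_mult_distrib del: of_nat_Suc)
  ultimately show ?thesis
    unfolding s_def t_def by simp
qed

text \<open>
  Adding the vertices of \<open>W\<close> to \<open>N\<close> one at a time creates all independent \<open>(n+2)\<close>-sets and
  those independent \<open>(n+1)\<close>-sets that do not lie in \<open>N\<close>. A bound on the ratio of the two numbers
  that holds at each addition therefore holds for the totals.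
\<close>

lemma top_count_peeling:
  fixes c :: real
  assumes E: "sym E" "irrefl E" and fin: "finite W" "finite N" and disj: "W \<inter> N = {}"
    and N: "card (indep_sets E N (Suc (Suc n))) = 0"
    and link: "\<And>w X. w \<in> W \<Longrightarrow> X \<subseteq> W \<union> N \<Longrightarrow>
      r * real (card (indep_sets E (non_nbrs E X w) (Suc n)))
        \<le> c * real (card (indep_sets E (non_nbrs E X w) n))"
  shows "r * real (card (indep_sets E (W \<union> N) (Suc (Suc n)))) \<le>
    c * (real (card (indep_sets E (W \<union> N) (Suc n))) - real (card (indep_sets E N (Suc n))))"
  using fin(1) disj link
proof (induction W rule: finite_induct)
  case empty
  thus ?case using N by simp
next
  case (insert w W)
  let ?X = "W \<union> N"
  have IH: "r * real (card (indep_sets E ?X (Suc (Suc n)))) \<le>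
      c * (real (card (indep_sets E ?X (Suc n))) - real (card (indep_sets E N (Suc n))))"
  proof (rule insert.IH)
    show "W \<inter> N = {}" using insert.prems(1) by simp
    show "r * real (card (indep_sets E (non_nbrs E X w') (Suc n)))
        \<le> c * real (card (indep_sets E (non_nbrs E X w') n))"
      if "w' \<in> W" "X \<subseteq> W \<union> N" for w' X
      by (rule insert.prems(2)) (use that in auto)
  qed
  have new: "r * real (card (indep_sets E (non_nbrs E ?X w) (Suc n)))
      \<le> c * real (card (indep_sets E (non_nbrs E ?X w) n))"
    by (rule insert.prems) auto
  have w: "w \<notin> ?X" and X: "finite ?X"
    using insert fin by auto
  have eq: "insert w W \<union> N = insert w ?X" by simp
  show ?case
    unfolding eq card_indep_sets_insert[OF E X w] using IH new
    by (simp add: algebra_simps)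
qed

text \<open>
  Equality holds for the disjoint unions of \<open>n+1\<close> cliques of equal size. There the
  non-neighbours of \<open>v\<close> are the vertices outside the clique of \<open>v\<close>, so the peeling of the
  complement of \<open>N\<close> loses nothing.
\<close>

lemma top_indep_counts_inequality:
  assumes E: "sym E" "irrefl E" and "finite U" "card (indep_sets E U (Suc (Suc n))) = 0"
  shows "Suc n ^ Suc n * card (indep_sets E U (Suc n)) ^ n \<le> card (indep_sets E U n) ^ Suc n"
  using assms(3,4)
proof (induction n arbitrary: U)
  case 0
  thus ?case by (simp add: indep_sets_0)
next
  case (Suc n)
  note fin = Suc.prems(1)
  let ?i = "\<lambda>X k. card (indep_sets E X k)"
  define d where "d = (\<lambda>v. ?i (non_nbrs E U v) (Suc n))"
  define K where "K = ?i U (Suc (Suc n))"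
  show ?case
  proof (cases "K = 0")
    case True
    thus ?thesis by (simp add: K_def)
  next
    case False
    hence ne: "U \<noteq> {}"
      by (auto simp: K_def indep_sets_empty_Suc)
    have split: "?i U (Suc k) = ?i (U - {v}) (Suc k) + ?i (non_nbrs E U v) k" if "v \<in> U" for v k
    proof -
      have "non_nbrs E (U - {v}) v = non_nbrs E U v" by (auto simp: non_nbrs_def)
      thus ?thesis
        using card_indep_sets_insert[OF E, of "U - {v}" v k] fin that by (simp add: insert_absorb)
    qed
    (* A vertex of largest d makes N large, and makes A bound the counts at all other vertices. *)
    define A where "A = Max (d ` U)"
    have "A \<in> d ` U"
      unfolding A_def by (rule Max_in) (use fin ne in simp_all)
    then obtain v where v: "v \<in> U" "d v = A"
      by (elim imageE) simp
    have le_A: "d w \<le> A" if "w \<in> U" for w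
      unfolding A_def using fin that by simp
    define N where "N = non_nbrs E U v"
    define c where "c = root (Suc n) (real A)"
    have c0: "c \<ge> 0" and cA: "c ^ Suc n = real A"
      by (simp_all add: c_def del: power_Suc)
    have "real (Suc n) * real (?i ((U - N) \<union> N) (Suc (Suc n))) \<le>
        c * (real (?i ((U - N) \<union> N) (Suc n)) - real (?i N (Suc n)))"
    proof (rule top_count_peeling[OF E])
      show "?i N (Suc (Suc n)) = 0"
        using split[OF v(1), of "Suc (Suc n)"] Suc.prems(2) by (simp add: N_def)
    next
      fix w X assume w: "w \<in> U - N" and "X \<subseteq> (U - N) \<union> N"
      hence X: "X \<subseteq> U" by (auto simp: N_def non_nbrs_def)
      let ?L = "non_nbrs E X w"
      let ?a = "?i ?L (Suc n)" and ?b = "?i ?L n"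
      have sub: "?L \<subseteq> non_nbrs E U w"
        using X by (auto simp: non_nbrs_def)
      have finL: "finite (non_nbrs E U w)"
        using fin by (rule finite_non_nbrs)
      have "?i (non_nbrs E U w) (Suc (Suc n)) = 0"
        using split[of w "Suc (Suc n)"] Suc.prems(2) w by simp
      hence "?i ?L (Suc (Suc n)) = 0"
        using card_indep_sets_mono[OF sub finL, of E "Suc (Suc n)"] by simp
      hence "Suc n ^ Suc n * ?a ^ n \<le> ?b ^ Suc n"
        using Suc.IH finite_subset[OF sub finL] by blast
      moreover have "?a \<le> A"
        using card_indep_sets_mono[OF sub finL, of E "Suc n"] le_A[of w] w
        unfolding d_def by simp
      (* Multiplying the induction hypothesis by a \<le> A makes both sides powers with exponent n + 1,
         as A = c ^ (n + 1). *)
      ultimately have "(Suc n ^ Suc n * ?a ^ n) * ?a \<le> ?b ^ Suc n * A"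
        by (rule mult_le_mono)
      hence "(Suc n * ?a) ^ Suc n \<le> A * ?b ^ Suc n"
        by (simp only: power_mult_distrib power_Suc2 mult_ac)
      hence "real ((Suc n * ?a) ^ Suc n) \<le> real (A * ?b ^ Suc n)"
        by (simp only: of_nat_le_iff)
      hence "(real (Suc n) * real ?a) ^ Suc n \<le> (c * real ?b) ^ Suc n"
        by (simp only: of_nat_mult of_nat_power power_mult_distrib cA)
      thus "real (Suc n) * real ?a \<le> c * real ?b"
        by (rule power_le_imp_le_base) (simp add: c0)
    qed (use fin in \<open>auto simp: N_def non_nbrs_def\<close>)
    moreover have "(U - N) \<union> N = U"
      by (auto simp: N_def non_nbrs_def)
    moreover have "?i N (Suc n) = A"
      using v by (simp add: N_def d_def)
    ultimately have peel: "real (Suc n) * real K \<le> c * (real (?i U (Suc n)) - c ^ Suc n)"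
      unfolding K_def cA by simp
    have "real (Suc n) * real K > 0"
      using False by simp
    hence "c \<noteq> 0"
      using peel by auto
    hence c: "c > 0" using c0 by simp
    (* The inequality of the means turns this into a bound in which A and c do not occur. *)
    have "real (Suc (Suc n)) ^ Suc (Suc n) * real K ^ Suc n
        \<le> (c ^ Suc n + real (Suc n) * (real K / c)) ^ Suc (Suc n)"
      using False c by (intro am_gm_power) auto
    also have "\<dots> \<le> real (?i U (Suc n)) ^ Suc (Suc n)"
    proof (rule power_mono)
      have "real (Suc n) * (real K / c) \<le> real (?i U (Suc n)) - c ^ Suc n"
        using peel c by (simp add: pos_divide_le_eq mult.commute)
      thus "c ^ Suc n + real (Suc n) * (real K / c) \<le> real (?i U (Suc n))" by simp
    qed (use c in simp)
    finally show ?thesis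
      unfolding K_def by (simp only: of_nat_power[symmetric] of_nat_mult[symmetric] of_nat_le_iff)
  qed
qed

section \<open>The sizes of the layers\<close>

text \<open>
  The generating function of these numbers is \<open>x (1 - x)\<^sup>m / (1 - (m + 1) x)\<close>. Layer \<open>t\<close> will have
  \<open>m * layer_coeff m (m - t)\<close> vertices. The formula comes from the required identities: they say that
  \<open>\<Sum>\<^sub>t v\<^sub>t (1 + x)\<^sup>t = \<Sum>\<^sub>k m\<^sup>m\<^sup>-\<^sup>1\<^sup>-\<^sup>k x\<^sup>k\<close>, which is \<open>(m\<^sup>m - x\<^sup>m) / (m - x)\<close>. Substituting \<open>y = 1 + x\<close>
  and comparing coefficients of \<open>y\<close> gives the recursion, read from the highest layer downwards.
\<close>

fun layer_coeff :: "nat \<Rightarrow> nat \<Rightarrow> int" where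
  "layer_coeff m 0 = 0"
| "layer_coeff m (Suc j) = int (Suc m) * layer_coeff m j + (-1) ^ j * int (m choose j)"

lemma two_times_next_binomial_le: "2 * (m choose (i + 3)) \<le> Suc m * (m choose (i + 2))"
proof -
  have "2 * (m choose (i + 3)) \<le> (i + 3) * (m choose (i + 3))"
    by simp
  also have "\<dots> = (m - (i + 2)) * (m choose (i + 2))"
    using binomial_absorb_comp[of m "i + 2"] binomial_absorption[of "i + 2" m]
    by (simp add: eval_nat_numeral)
  also have "\<dots> \<le> Suc m * (m choose (i + 2))"
    by (intro mult_le_mono) auto
  finally show ?thesis .
qed

text \<open>
  The alternating term of the recursion may be negative. It is dominated because each step multiplies by
  \<open>m + 1\<close>, while binomial coefficients from index 2 on grow by a factor of at most \<open>(m + 1) / 2\<close>.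
  The bound starts at the third number; the second one is \<open>1\<close>, below \<open>m choose 1\<close> for \<open>m \<ge> 2\<close>.
\<close>

lemma layer_coeff_ge_binomial: "int (m choose (i + 2)) \<le> layer_coeff m (i + 3)"
proof (induction i)
  case 0
  have "layer_coeff m (Suc (Suc (Suc 0))) = int (Suc m) + int (m choose Suc (Suc 0))"
    by simp
  thus ?case by (simp add: numeral_3_eq_3 numeral_2_eq_2 del: layer_coeff.simps)
next
  case (Suc i)
  have "int (2 * (m choose (i + 3))) \<le> int (Suc m * (m choose (i + 2)))"
    using two_times_next_binomial_le[of m i] by (simp only: of_nat_le_iff)
  hence "2 * int (m choose (i + 3)) \<le> int (Suc m) * int (m choose (i + 2))"
    by (simp only: of_nat_mult of_nat_numeral)
  also have "\<dots> \<le> int (Suc m) * layer_coeff m (i + 3)"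
    by (intro mult_left_mono Suc.IH) simp
  finally have "2 * int (m choose (i + 3)) \<le> int (Suc m) * layer_coeff m (i + 3)" .
  moreover have "- int (m choose (i + 3)) \<le> (-1) ^ (i + 3) * int (m choose (i + 3))"
    by (cases "even (i + 3)") simp_all
  moreover have "layer_coeff m (Suc i + 3) =
      int (Suc m) * layer_coeff m (i + 3) + (-1) ^ (i + 3) * int (m choose (i + 3))"
    by (simp only: add_Suc layer_coeff.simps)
  ultimately show ?case
    by (simp only: add_Suc) (simp add: eval_nat_numeral)
qed

lemma layer_coeff_pos:
  assumes "1 \<le> j" "j \<le> m"
  shows "1 \<le> layer_coeff m j"
proof -
  consider "j = 1" | "j = 2" | "3 \<le> j"
    using assms(1) by linarith
  thus ?thesis
  proof cases
    case 3
    then obtain i where j: "j = i + 3"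
      by (metis add.commute le_Suc_ex)
    have "0 < m choose (i + 2)"
      using assms j by (intro zero_less_binomial) simp
    thus ?thesis
      using layer_coeff_ge_binomial[of m i] unfolding j by linarith
  qed (use assms in \<open>simp_all add: eval_nat_numeral\<close>)
qed

text \<open>
  This is the orthogonality of binomial inversion. The product is rewritten as
  \<open>(m choose k) (m - k choose m - t)\<close>, which leaves the alternating sum of a row of Pascal's triangle.
\<close>

lemma alternating_binomial_product_sum:
  assumes "k < m"
  shows "(\<Sum>t\<le>m. (-1) ^ (m - t) * int (m choose t) * int (t choose k)) = 0"
proof -
  have "(\<Sum>t\<le>m. (-1) ^ (m - t) * int (m choose t) * int (t choose k))
      = (\<Sum>i\<le>m. (-1) ^ i * int (m choose (m - i)) * int ((m - i) choose k))"
    by (rule sum.reindex_bij_witness[of _ "\<lambda>i. m - i" "\<lambda>i. m - i"]) auto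
  also have "\<dots> = (\<Sum>i\<le>m - k. (-1) ^ i * int (m choose (m - i)) * int ((m - i) choose k))"
    by (rule sum.mono_neutral_right) (auto simp: not_le)
  also have "\<dots> = (\<Sum>i\<le>m - k. int (m choose k) * ((-1) ^ i * int ((m - k) choose i)))"
  proof (rule sum.cong)
    fix i assume "i \<in> {..m - k}"
    hence "(m choose (m - i)) * ((m - i) choose k) = (m choose k) * ((m - k) choose (m - i - k))"
      using assms by (intro choose_mult) auto
    also have "(m - k) choose (m - i - k) = (m - k) choose i"
      using \<open>i \<in> {..m - k}\<close> binomial_symmetric[of i "m - k"] by (simp add: add.commute diff_diff_add)
    finally have "int (m choose (m - i)) * int ((m - i) choose k) = int (m choose k) * int ((m - k) choose i)"
      by (simp only: of_nat_mult[symmetric])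
    thus "(-1) ^ i * int (m choose (m - i)) * int ((m - i) choose k) =
        int (m choose k) * ((-1) ^ i * int ((m - k) choose i))"
      by (simp add: mult_ac)
  qed simp
  also have "\<dots> = int (m choose k) * (\<Sum>i\<le>m - k. (-1) ^ i * int ((m - k) choose i))"
    by (simp add: sum_distrib_left)
  also have "(\<Sum>i\<le>m - k. (-1) ^ i * int ((m - k) choose i)) = 0"
    using choose_alternating_sum[of "m - k", where 'a = int] assms by simp
  finally show ?thesis by simp
qed

text \<open>
  The sum of \<open>layer_coeff m (m - t) (t + 1 choose k + 1)\<close> is evaluated in two ways: Pascal's rule splits it
  into the sums for \<open>k\<close> and \<open>k + 1\<close>, while the recursion makes it \<open>m + 1\<close> times the sum
  for \<open>k + 1\<close>, the alternating terms cancelling by orthogonality.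
\<close>

lemma layer_coeff_binomial_sum_step:
  assumes "Suc k < m"
  shows "(\<Sum>t<m. layer_coeff m (m - t) * int (t choose k)) =
    int m * (\<Sum>t<m. layer_coeff m (m - t) * int (t choose Suc k))"
proof -
  let ?S = "\<lambda>k. \<Sum>t<m. layer_coeff m (m - t) * int (t choose k)"
  have shift: "(\<Sum>t<m. g (Suc t)) = (\<Sum>t\<le>m. g t)" if "g 0 = 0" for g :: "nat \<Rightarrow> int"
    using that by (simp only: lessThan_Suc_atMost[symmetric] sum.lessThan_Suc_shift add_0)
  have "?S k + ?S (Suc k) = (\<Sum>t<m. layer_coeff m (m - t) * int (Suc t choose Suc k))"
    by (simp add: sum.distrib[symmetric] algebra_simps)
  also have "\<dots> = (\<Sum>t<m. int (Suc m) * (layer_coeff m (m - Suc t) * int (Suc t choose Suc k))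
      + (-1) ^ (m - Suc t) * int (m choose Suc t) * int (Suc t choose Suc k))"
  proof (rule sum.cong)
    fix t assume "t \<in> {..<m}"
    hence "layer_coeff m (m - t) = layer_coeff m (Suc (m - Suc t))"
      by (simp add: Suc_diff_Suc)
    also have "\<dots> = int (Suc m) * layer_coeff m (m - Suc t) + (-1) ^ (m - Suc t) * int (m choose Suc t)"
      using \<open>t \<in> {..<m}\<close> binomial_symmetric[of "Suc t" m] by simp
    finally show "layer_coeff m (m - t) * int (Suc t choose Suc k) =
        int (Suc m) * (layer_coeff m (m - Suc t) * int (Suc t choose Suc k))
        + (-1) ^ (m - Suc t) * int (m choose Suc t) * int (Suc t choose Suc k)"
      by (simp only: distrib_right mult.assoc)
  qed simp
  also have "\<dots> = int (Suc m) * (\<Sum>t<m. layer_coeff m (m - Suc t) * int (Suc t choose Suc k))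
      + (\<Sum>t<m. (-1) ^ (m - Suc t) * int (m choose Suc t) * int (Suc t choose Suc k))"
    by (simp only: sum.distrib sum_distrib_left)
  also have "(\<Sum>t<m. (-1) ^ (m - Suc t) * int (m choose Suc t) * int (Suc t choose Suc k)) = 0"
    using alternating_binomial_product_sum[OF assms]
    by (subst shift[of "\<lambda>t. (-1) ^ (m - t) * int (m choose t) * int (t choose Suc k)"]) simp_all
  also have "(\<Sum>t<m. layer_coeff m (m - Suc t) * int (Suc t choose Suc k)) = ?S (Suc k)"
    by (subst shift[of "\<lambda>t. layer_coeff m (m - t) * int (t choose Suc k)"])
      (simp_all add: lessThan_Suc_atMost[symmetric])
  finally show ?thesis by (simp add: algebra_simps)
qed

lemma layer_coeff_binomial_sum:
  assumes "k < m"
  shows "(\<Sum>t<m. layer_coeff m (m - t) * int (t choose k)) = int m ^ (m - Suc k)"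
proof -
  have "k \<le> m - 1" using assms by simp
  thus ?thesis
  proof (induction k rule: inc_induct)
    case base
    obtain n where m: "m = Suc n" using assms by (cases m) auto
    have "(\<Sum>t<n. layer_coeff m (m - t) * int (t choose n)) = 0"
      by (intro sum.neutral) auto
    thus ?case by (simp add: m)
  next
    case (step k)
    hence k: "Suc k < m" by simp
    hence "m - Suc k = Suc (m - Suc (Suc k))" by simp
    thus ?case
      using layer_coeff_binomial_sum_step[OF k] step.IH by simp
  qed
qed

section \<open>The layered graph\<close>

text \<open>
  In the layered graph \<open>X\<close> will be a layer and \<open>U\<close> the union of the lower ones. An independent set
  takes at most one vertex from \<open>X\<close>, and each vertex of \<open>X\<close> contributes the same number of sets.
\<close>

lemma card_indep_sets_add_clique:
  assumes E: "sym E" "irrefl E" and fin: "finite X" "finite U" and "X \<inter> U = {}"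
    and "\<And>x y. x \<in> X \<Longrightarrow> y \<in> X \<Longrightarrow> x \<noteq> y \<Longrightarrow> (x, y) \<in> E"
    and "\<And>x. x \<in> X \<Longrightarrow> {u \<in> U. (x, u) \<notin> E} = L"
  shows "card (indep_sets E (X \<union> U) (Suc k)) =
    card (indep_sets E U (Suc k)) + card X * card (indep_sets E L k)"
  using fin(1) assms(5-7)
proof (induction X rule: finite_induct)
  case empty
  thus ?case by simp
next
  case (insert x X)
  have "non_nbrs E (X \<union> U) x = {u \<in> U. (x, u) \<notin> E}"
    using insert.hyps insert.prems(1) insert.prems(2)[of x] by (auto simp: non_nbrs_def)
  also have "\<dots> = L" by (rule insert.prems) simp
  finally have L: "non_nbrs E (X \<union> U) x = L" .
  have IH: "card (indep_sets E (X \<union> U) (Suc k)) =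
      card (indep_sets E U (Suc k)) + card X * card (indep_sets E L k)"
    by (rule insert.IH) (use insert.prems in auto)
  show ?case
    using card_indep_sets_insert[OF E, of "X \<union> U" x k] insert.hyps insert.prems fin IH L
    by simp
qed

text \<open>
  The natural number \<open>m * x + t\<close> with \<open>t < m\<close> stands for the vertex number \<open>x\<close> of layer \<open>t\<close>; it is
  core if \<open>x < m\<close>. The relation below says that \<open>u\<close> is a core vertex in a lower layer than \<open>v\<close>. Those
  are the pairs that are left non-adjacent, so that independent sets play the role of the cliques
  of the complement.
\<close>

definition layered_below :: "nat \<Rightarrow> nat \<Rightarrow> nat \<Rightarrow> bool" where
  "layered_below m u v \<longleftrightarrow> u mod m < v mod m \<and> u div m < m"

definition layered_arcs :: "nat \<Rightarrow> (nat \<times> nat) set" where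
  "layered_arcs m = {(u, v). u \<noteq> v \<and> \<not> layered_below m u v \<and> \<not> layered_below m v u}"

text \<open>
  The first \<open>s\<close> layers, layer \<open>t\<close> being cut to its first \<open>f t\<close> vertices. For constant
  \<open>f = m\<close> these are the core vertices.
\<close>

definition layered_verts :: "nat \<Rightarrow> (nat \<Rightarrow> nat) \<Rightarrow> nat \<Rightarrow> nat set" where
  "layered_verts m f s = {v. v mod m < s \<and> v div m < f (v mod m)}"

lemma layered_arcs_sym: "sym (layered_arcs m)" and layered_arcs_irrefl: "irrefl (layered_arcs m)"
  by (auto simp: layered_arcs_def sym_def irrefl_def)

lemma layer_eq:
  fixes m :: nat
  assumes "s < m"
  shows "{v. v mod m = s \<and> v div m < n} = (\<lambda>x. m * x + s) ` {..<n}"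
proof (intro equalityI subsetI)
  fix v assume "v \<in> {v. v mod m = s \<and> v div m < n}"
  thus "v \<in> (\<lambda>x. m * x + s) ` {..<n}"
    by (intro image_eqI[of _ _ "v div m"]) (use mult_div_mod_eq[of m v] in auto)
qed (use assms in auto)

lemma card_layer:
  fixes m :: nat
  assumes "s < m"
  shows "card {v. v mod m = s \<and> v div m < n} = n" "finite {v. v mod m = s \<and> v div m < n}"
  using assms by (auto simp: layer_eq card_image inj_on_def)

lemma layered_verts_Suc:
  "layered_verts m f (Suc s) = {v. v mod m = s \<and> v div m < f s} \<union> layered_verts m f s"
  by (auto simp: layered_verts_def less_Suc_eq)

lemma finite_layered_verts: "s \<le> m \<Longrightarrow> finite (layered_verts m f s)"
proof (induction s)
  case (Suc s)
  thus ?case by (simp add: layered_verts_Suc card_layer)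
qed (simp add: layered_verts_def)

lemma card_indep_sets_layered_Suc:
  assumes "s < m" and f: "\<And>t. t < m \<Longrightarrow> m \<le> f t"
  shows "card (indep_sets (layered_arcs m) (layered_verts m f (Suc s)) (Suc k)) =
    card (indep_sets (layered_arcs m) (layered_verts m f s) (Suc k)) +
    f s * card (indep_sets (layered_arcs m) (layered_verts m (\<lambda>_. m) s) k)"
proof -
  let ?X = "{v. v mod m = s \<and> v div m < f s}"
  have "card (indep_sets (layered_arcs m) (?X \<union> layered_verts m f s) (Suc k)) =
    card (indep_sets (layered_arcs m) (layered_verts m f s) (Suc k)) +
    card ?X * card (indep_sets (layered_arcs m) (layered_verts m (\<lambda>_. m) s) k)"
  proof (rule card_indep_sets_add_clique[OF layered_arcs_sym layered_arcs_irrefl])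
    fix x assume x: "x \<in> ?X"
    show "{u \<in> layered_verts m f s. (x, u) \<notin> layered_arcs m} = layered_verts m (\<lambda>_. m) s"
    proof (intro equalityI subsetI)
      fix u assume "u \<in> layered_verts m (\<lambda>_. m) s"
      thus "u \<in> {u \<in> layered_verts m f s. (x, u) \<notin> layered_arcs m}"
        using x f[of "u mod m"] assms(1)
        by (auto simp: layered_verts_def layered_arcs_def layered_below_def)
    qed (use x in \<open>auto simp: layered_verts_def layered_arcs_def layered_below_def\<close>)
  qed (use assms in \<open>auto simp: card_layer finite_layered_verts\<close>,
      auto simp: layered_verts_def layered_arcs_def layered_below_def)
  thus ?thesis
    using assms(1) by (simp add: layered_verts_Suc card_layer)
qed

text \<open>
  Among core vertices, an independent set is a choice of layers and of one of \<open>m\<close> vertices in each.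
\<close>

lemma card_indep_sets_core:
  "s \<le> m \<Longrightarrow> card (indep_sets (layered_arcs m) (layered_verts m (\<lambda>_. m) s) k) = (s choose k) * m ^ k"
proof (induction s arbitrary: k)
  case 0
  show ?case
    by (cases k) (simp_all add: layered_verts_def indep_sets_0 indep_sets_empty_Suc)
next
  case (Suc s)
  show ?case
  proof (cases k)
    case 0
    thus ?thesis using Suc.prems by (simp add: indep_sets_0 finite_layered_verts)
  next
    case (Suc l)
    thus ?thesis
      using Suc.prems Suc.IH card_indep_sets_layered_Suc[of s m "\<lambda>_. m" l]
      by (simp add: algebra_simps)
  qed
qed

text \<open>
  The summand for \<open>t\<close> counts the sets whose highest vertex lies in layer \<open>t\<close>: the other \<open>k\<close>
  vertices form an independent set of core vertices in the \<open>t\<close> lower layers.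
\<close>

lemma card_indep_sets_layered:
  assumes "\<And>t. t < m \<Longrightarrow> m \<le> f t"
  shows "s \<le> m \<Longrightarrow> card (indep_sets (layered_arcs m) (layered_verts m f s) (Suc k)) =
    (\<Sum>t<s. f t * (t choose k)) * m ^ k"
proof (induction s)
  case 0
  show ?case by (simp add: layered_verts_def indep_sets_empty_Suc)
next
  case (Suc s)
  thus ?case
    using card_indep_sets_layered_Suc[of s m f k] assms
    by (simp add: card_indep_sets_core algebra_simps)
qed

definition layer_size :: "nat \<Rightarrow> nat \<Rightarrow> nat" where
  "layer_size m t = m * nat (layer_coeff m (m - t))"

lemma layer_size_ge: "t < m \<Longrightarrow> m \<le> layer_size m t"
  using layer_coeff_pos[of "m - t" m] by (simp add: layer_size_def Suc_le_eq)

lemma layer_size_sum: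
  assumes "k < m"
  shows "(\<Sum>t<m. layer_size m t * (t choose k)) = m ^ (m - k)"
proof -
  have "int (\<Sum>t<m. layer_size m t * (t choose k)) =
      (\<Sum>t<m. int m * (layer_coeff m (m - t) * int (t choose k)))"
    unfolding of_nat_sum
  proof (rule sum.cong)
    fix t assume "t \<in> {..<m}"
    hence "1 \<le> layer_coeff m (m - t)"
      by (intro layer_coeff_pos) auto
    thus "int (layer_size m t * (t choose k)) = int m * (layer_coeff m (m - t) * int (t choose k))"
      by (simp add: layer_size_def)
  qed simp
  also have "\<dots> = int m * int m ^ (m - Suc k)"
    using layer_coeff_binomial_sum[OF assms] by (simp add: sum_distrib_left[symmetric])
  also have "\<dots> = int (m ^ (m - k))"
  proof -
    have "m - k = Suc (m - Suc k)" using assms by simp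
    thus ?thesis by simp
  qed
  finally show ?thesis by (simp only: of_nat_eq_iff)
qed

lemma card_indep_sets_layered_graph:
  "card (indep_sets (layered_arcs m) (layered_verts m (layer_size m) m) (Suc k)) =
    (if k < m then m ^ m else 0)"
proof (cases "k < m")
  case True
  thus ?thesis
    by (simp add: card_indep_sets_layered layer_size_ge layer_size_sum flip: power_add)
next
  case False
  hence "(\<Sum>t<m. layer_size m t * (t choose k)) = 0"
    by (intro sum.neutral) auto
  thus ?thesis
    using False by (simp add: card_indep_sets_layered layer_size_ge)
qed

section \<open>Independent set counts of graphs\<close>

lemma indep_count_eq: "indep_count G k = card (indep_sets (parcs G) (pverts G) k)"
  by (simp add: indep_count_def independent_set_def indep_sets_def conj_assoc)

lemma pair_graph_iff:
  "pair_graph G \<longleftrightarrow> finite (pverts G) \<and> parcs G \<subseteq> pverts G \<times> pverts G \<and>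
    sym (parcs G) \<and> irrefl (parcs G)"
proof
  assume "pair_graph G"
  then interpret pair_graph G .
  have loop: "(v, v) \<notin> parcs G" for v
    using no_loops'[of v v] by auto
  show "finite (pverts G) \<and> parcs G \<subseteq> pverts G \<times> pverts G \<and> sym (parcs G) \<and> irrefl (parcs G)"
    using pair_finite_verts in_arcsD1 in_arcsD2 pair_sym_arcs loop
    by (auto simp: symmetric_def irrefl_def)
next
  assume G: "finite (pverts G) \<and> parcs G \<subseteq> pverts G \<times> pverts G \<and> sym (parcs G) \<and> irrefl (parcs G)"
  hence "finite (parcs G)"
    using finite_subset[of "parcs G" "pverts G \<times> pverts G"] by simp
  thus "pair_graph G"
    using G by unfold_locales (auto simp: symmetric_def irrefl_def)
qed

lemma indep_number_eqI:
  assumes "finite (pverts G)" and "indep_count G m \<noteq> 0" and "\<And>k. m < k \<Longrightarrow> indep_count G k = 0"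
  shows "indep_number G = m"
  unfolding indep_number_def
proof (rule Max_eqI)
  have fin: "finite {S. independent_set G S}"
    by (rule finite_subset[of _ "Pow (pverts G)"]) (use assms(1) in \<open>auto simp: independent_set_def\<close>)
  thus "finite (card ` {S. independent_set G S})" by simp
  have "{S. independent_set G S \<and> card S = m} \<noteq> {}"
    using assms(2) unfolding indep_count_def by (metis card.empty)
  thus "m \<in> card ` {S. independent_set G S}" by blast
  fix k assume "k \<in> card ` {S. independent_set G S}"
  then obtain S where S: "independent_set G S" "card S = k" by blast
  have "finite {S. independent_set G S \<and> card S = k}"
    using fin by (rule rev_finite_subset) auto
  hence "indep_count G k \<noteq> 0"
    unfolding indep_count_def using S by auto
  thus "k \<le> m"
    using assms(3)[of k] by (meson not_le)
qed

lemma indep_count_indep_number: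
  assumes "finite (pverts G)"
  shows "indep_count G (indep_number G) \<noteq> 0"
    and "indep_number G < k \<Longrightarrow> indep_count G k = 0"
proof -
  have fin: "finite {S. independent_set G S}"
    by (rule finite_subset[of _ "Pow (pverts G)"]) (use assms in \<open>auto simp: independent_set_def\<close>)
  have "independent_set G {}" by (simp add: independent_set_def)
  hence "indep_number G \<in> card ` {S. independent_set G S}"
    unfolding indep_number_def using fin by (intro Max_in) auto
  then obtain S where S: "independent_set G S" "card S = indep_number G" by auto
  have "finite {S. independent_set G S \<and> card S = indep_number G}"
    using fin by (rule rev_finite_subset) auto
  thus "indep_count G (indep_number G) \<noteq> 0"
    unfolding indep_count_def using S by auto
  have "card S \<le> indep_number G" if "independent_set G S" for S
    unfolding indep_number_def using fin that by (intro Max_ge) auto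
  hence none: "{S. independent_set G S \<and> card S = k} = {}" if "indep_number G < k"
    using that by fastforce
  show "indep_count G k = 0" if "indep_number G < k"
    unfolding indep_count_def none[OF that] by simp
qed

lemma indep_count_1:
  assumes "pair_graph G"
  shows "indep_count G 1 = card (pverts G)"
proof -
  have "irrefl (parcs G)" using assms by (simp add: pair_graph_iff)
  hence "indep_sets (parcs G) (pverts G) 1 = (\<lambda>v. {v}) ` pverts G"
    by (auto simp: indep_sets_def irrefl_def card_1_singleton_iff)
  thus ?thesis by (simp add: indep_count_eq card_image)
qed

text \<open>
  If \<open>i\<^sub>m\<^sub>-\<^sub>1 \<le> i\<^sub>m\<close>, then \<open>m\<^sup>m i\<^sub>m\<^sup>m\<^sup>-\<^sup>1 \<le> i\<^sub>m\<^sub>-\<^sub>1\<^sup>m \<le> i\<^sub>m\<^sup>m\<close>, and \<open>i\<^sub>m\<close> is not zero and can be cancelled.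
\<close>

lemma indep_count_lt_predecessor:
  assumes G: "pair_graph G" and m: "indep_number G = m" "m \<ge> 1" and lt: "indep_count G m < m ^ m"
  shows "indep_count G m < indep_count G (m - 1)"
proof (rule ccontr)
  obtain n where n: "m = Suc n" using m(2) by (cases m) auto
  let ?i = "indep_count G"
  assume "\<not> ?i m < ?i (m - 1)"
  hence le: "?i n \<le> ?i m" by (simp add: n)
  have fin: "finite (pverts G)" using G by (simp add: pair_graph_iff)
  have pos: "?i m > 0" and zero: "?i (Suc m) = 0"
    using indep_count_indep_number[OF fin] m(1) by auto
  have "m ^ m * ?i m ^ n \<le> ?i n ^ m"
    using top_indep_counts_inequality[of "parcs G" "pverts G" n] G zero
    by (simp add: pair_graph_iff indep_count_eq n)
  also have "\<dots> \<le> ?i m ^ m"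
    using le by (rule power_mono) simp
  also have "\<dots> = ?i m * ?i m ^ n"
    by (simp add: n)
  finally have "m ^ m \<le> ?i m"
    using pos by simp
  thus False using lt by simp
qed

section \<open>The number of vertices that a permutation requires\<close>

definition layered_graph :: "nat \<Rightarrow> nat pair_pre_digraph" where
  "layered_graph m = (let V = layered_verts m (layer_size m) m
     in \<lparr>pverts = V, parcs = layered_arcs m \<inter> V \<times> V\<rparr>)"

lemma pair_graph_layered: "pair_graph (layered_graph m)"
  using layered_arcs_sym[of m] layered_arcs_irrefl[of m]
  by (auto simp: pair_graph_iff layered_graph_def Let_def finite_layered_verts sym_def irrefl_def)

lemma indep_count_layered: "indep_count (layered_graph m) (Suc k) = (if k < m then m ^ m else 0)"
proof -
  have "indep_sets (E \<inter> V \<times> V) V l = indep_sets E V l" for E :: "(nat \<times> nat) set" and V l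
    by (auto simp: indep_sets_def)
  thus ?thesis
    by (simp add: indep_count_eq layered_graph_def Let_def card_indep_sets_layered_graph)
qed

lemma card_verts_layered:
  assumes "m \<ge> 1"
  shows "card (pverts (layered_graph m)) = m ^ m"
  using assms indep_count_1[OF pair_graph_layered, of m] indep_count_layered[of m 0] by simp

lemma indep_number_layered:
  assumes "m \<ge> 1"
  shows "indep_number (layered_graph m) = m"
proof (rule indep_number_eqI)
  show "finite (pverts (layered_graph m))"
    using pair_graph_layered[of m] by (simp add: pair_graph_iff)
  show "indep_count (layered_graph m) m \<noteq> 0"
    using assms indep_count_layered[of m "m - 1"] by simp
  show "indep_count (layered_graph m) k = 0" if "m < k" for k
    using that indep_count_layered[of m "k - 1"] by simp
qed

lemma indep_count_layered_eq:
  assumes "k \<in> {1..m}"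
  shows "indep_count (layered_graph m) k = m ^ m"
  using assms indep_count_layered[of m "k - 1"] by (auto simp: Suc_diff_le)

lemma indep_set_permutation_layered:
  assumes "m \<ge> 1" "\<pi> permutes {1..m}"
  shows "indep_set_permutation (layered_graph m) \<pi>"
proof -
  have "indep_count (layered_graph m) (\<pi> j) = m ^ m" if "j \<in> {1..m}" for j
    using that permutes_in_image[OF assms(2)] by (intro indep_count_layered_eq) blast
  thus ?thesis
    using assms by (simp add: indep_set_permutation_def indep_number_layered)
qed

lemma max_min_vertices_le:
  assumes "m \<ge> 1"
  shows "max_min_vertices m \<le> m ^ m"
proof -
  have "min_vertices m \<pi> \<le> m ^ m" if "\<pi> permutes {1..m}" for \<pi>
    unfolding min_vertices_def
  proof (rule Least_le)
    show "\<exists>G :: nat pair_pre_digraph. pair_graph G \<and> indep_number G = m \<and>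
        indep_set_permutation G \<pi> \<and> card (pverts G) = m ^ m"
      using pair_graph_layered indep_number_layered[OF assms]
        indep_set_permutation_layered[OF assms that] card_verts_layered[OF assms] by blast
  qed
  moreover have "{\<pi>. \<pi> permutes {1..m}} \<noteq> {}"
    using permutes_id by blast
  ultimately show ?thesis
    unfolding max_min_vertices_def
    by (subst Max_le_iff) (simp_all add: finite_permutations)
qed

text \<open>
  A lower bound on all admissible graphs bounds the minimum only if the minimum is attained;
  the layered graph is an admissible one, so it is.
\<close>

lemma max_min_vertices_ge:
  assumes "m \<ge> 1" and \<pi>: "\<pi> permutes {1..m}"
    and n: "\<And>G :: nat pair_pre_digraph. pair_graph G \<Longrightarrow> indep_number G = m \<Longrightarrow>
      indep_set_permutation G \<pi> \<Longrightarrow> n \<le> card (pverts G)"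
  shows "n \<le> max_min_vertices m"
proof -
  let ?P = "\<lambda>n. \<exists>G :: nat pair_pre_digraph. pair_graph G \<and> indep_number G = m \<and>
        indep_set_permutation G \<pi> \<and> card (pverts G) = n"
  have "?P (m ^ m)"
    using pair_graph_layered indep_number_layered[OF assms(1)]
      indep_set_permutation_layered[OF assms(1) \<pi>] card_verts_layered[OF assms(1)] by blast
  hence "?P (min_vertices m \<pi>)"
    unfolding min_vertices_def by (rule LeastI)
  then obtain G :: "nat pair_pre_digraph" where "pair_graph G" "indep_number G = m"
    "indep_set_permutation G \<pi>" "card (pverts G) = min_vertices m \<pi>"
    by (elim exE conjE)
  hence "n \<le> min_vertices m \<pi>"
    using n[of G] by simp
  also have "\<dots> \<le> max_min_vertices m"
    unfolding max_min_vertices_def using \<pi> by (intro Max_ge) (auto simp: finite_permutations)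
  finally show ?thesis .
qed

definition cyclic_shift :: "nat \<Rightarrow> nat \<Rightarrow> nat" where
  "cyclic_shift m j = (if j = m then 1 else if j \<in> {1..<m} then j + 1 else j)"

lemma cyclic_shift_permutes:
  assumes "m \<ge> 1"
  shows "cyclic_shift m permutes {1..m}"
proof (rule bij_imp_permutes)
  show "bij_betw (cyclic_shift m) {1..m} {1..m}"
    by (rule bij_betw_byWitness[where f' = "\<lambda>j. if j = 1 then m else j - 1"])
      (use assms in \<open>auto simp: cyclic_shift_def\<close>)
qed (use assms in \<open>auto simp: cyclic_shift_def\<close>)

text \<open>
  The counts are ordered as \<open>i\<^sub>2 \<le> \<dots> \<le> i\<^sub>m \<le> i\<^sub>1\<close>. For \<open>m \<ge> 3\<close> this chain contains both
  \<open>i\<^sub>m\<^sub>-\<^sub>1 \<le> i\<^sub>m\<close>, which forces \<open>i\<^sub>m\<close> to be large, and \<open>i\<^sub>m \<le> i\<^sub>1\<close>, which transfers the bound to the number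
  of vertices.
\<close>

lemma cyclic_shift_needs_power:
  assumes G: "pair_graph G" and m: "indep_number G = m" "m \<ge> 3"
    and perm: "indep_set_permutation G (cyclic_shift m)"
  shows "m ^ m \<le> card (pverts G)"
proof -
  have chain: "indep_count G (cyclic_shift m j) \<le> indep_count G (cyclic_shift m (j + 1))"
    if "j \<in> {1..<m}" for j
    using perm that m(1) by (auto simp: indep_set_permutation_def)
  have "cyclic_shift m (m - 2) = m - 1" "cyclic_shift m (m - 2 + 1) = m"
    using m(2) by (auto simp: cyclic_shift_def)
  hence "indep_count G (m - 1) \<le> indep_count G m"
    using chain[of "m - 2"] m(2) by simp
  hence "m ^ m \<le> indep_count G m"
    using indep_count_lt_predecessor[OF G m(1)] m(2) by fastforce
  also have "\<dots> \<le> indep_count G 1"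
  proof -
    have "cyclic_shift m (m - 1) = m" "cyclic_shift m (m - 1 + 1) = 1"
      using m(2) by (auto simp: cyclic_shift_def)
    thus ?thesis
      using chain[of "m - 1"] m(2) by simp
  qed
  also have "\<dots> = card (pverts G)"
    by (rule indep_count_1[OF G])
  finally show ?thesis .
qed

text \<open>
  With \<open>i\<^sub>1 \<le> i\<^sub>2\<close> there are at least four independent pairs, but three vertices span only three pairs.
\<close>

lemma identity_needs_four:
  assumes G: "pair_graph G" and two: "indep_number G = 2" and perm: "indep_set_permutation G id"
  shows "4 \<le> card (pverts G)"
proof (rule ccontr)
  assume "\<not> 4 \<le> card (pverts G)"
  hence "card (pverts G) \<in> {0, 1, 2, 3}" by auto
  hence "card (pverts G) choose 2 \<le> 3"
    by (auto simp: eval_nat_numeral)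
  moreover have "indep_count G 2 \<le> card {S. S \<subseteq> pverts G \<and> card S = 2}"
    unfolding indep_count_def independent_set_def
    by (rule card_mono) (use G in \<open>auto simp: pair_graph_iff\<close>)
  moreover have "card {S. S \<subseteq> pverts G \<and> card S = 2} = card (pverts G) choose 2"
    using G by (intro n_subsets) (simp add: pair_graph_iff)
  moreover have "indep_count G 1 \<le> indep_count G 2"
    using perm two by (auto simp: indep_set_permutation_def numeral_2_eq_2)
  ultimately show False
    using indep_count_lt_predecessor[OF G two] by simp
qed

lemma power_le_max_min_vertices:
  assumes "m \<ge> 1"
  shows "m ^ m \<le> max_min_vertices m"
proof -
  consider "m = 1" | "m = 2" | "m \<ge> 3" using assms by linarith
  thus ?thesis
  proof cases
    case 1
    have "1 \<le> card (pverts G)" if "pair_graph G" "indep_number G = 1" for G :: "nat pair_pre_digraph"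
      using that indep_count_indep_number(1)[of G] indep_count_1[of G]
      by (simp add: pair_graph_iff)
    thus ?thesis
      using 1 max_min_vertices_ge[OF assms permutes_id, of 1] by simp
  next
    case 2
    have "4 \<le> max_min_vertices m"
      by (rule max_min_vertices_ge[OF assms permutes_id]) (use 2 identity_needs_four in simp)
    thus ?thesis using 2 by simp
  next
    case 3
    thus ?thesis
      using max_min_vertices_ge[OF assms cyclic_shift_permutes[OF assms]] cyclic_shift_needs_power by blast
  qed
qed

theorem theorem1p3:
  shows "(\<forall>m::nat. m \<ge> 1 \<longrightarrow>
            (\<exists>G :: nat pair_pre_digraph. pair_graph G \<and> card (pverts G) = m ^ m \<and>
               indep_number G = m \<and> (\<forall>k\<in>{1..m}. indep_count G k = m ^ m)) \<and>
            max_min_vertices m \<le> m ^ m) \<and>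
         (\<forall>m::nat. m \<ge> 1 \<longrightarrow>
            (\<forall>G :: 'a pair_pre_digraph. pair_graph G \<longrightarrow> indep_number G = m \<longrightarrow>
               indep_count G m < m ^ m \<longrightarrow> indep_count G m < indep_count G (m - 1)) \<and>
            max_min_vertices m \<ge> m ^ m)"
proof (intro conjI allI impI)
  fix m :: nat assume m: "m \<ge> 1"
  show "\<exists>G :: nat pair_pre_digraph. pair_graph G \<and> card (pverts G) = m ^ m \<and>
      indep_number G = m \<and> (\<forall>k\<in>{1..m}. indep_count G k = m ^ m)"
    using pair_graph_layered card_verts_layered[OF m] indep_number_layered[OF m]
      indep_count_layered_eq by blast
  show "max_min_vertices m \<le> m ^ m" "m ^ m \<le> max_min_vertices m"
    using max_min_vertices_le[OF m] power_le_max_min_vertices[OF m] .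
next
  fix m :: nat and G :: "'a pair_pre_digraph"
  assume "m \<ge> 1" "pair_graph G" "indep_number G = m" "indep_count G m < m ^ m"
  thus "indep_count G m < indep_count G (m - 1)"
    by (intro indep_count_lt_predecessor)
qed

end
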